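(* For every integer $k\ge 1$, the class of functions $\Sigma^*\to\mathbb{Z}_\infty$ ($\Sigma$ a finite alphabet) representable by a $k$-CRA is exactly the class of functions representable by WFAs of width $k$.
   Context: Write $\mathbb{Z}_\infty=\mathbb{Z}\cup\{\infty\}$ and $[k]=\{1,\ldots,k\}$; matrix products are over the semiring $(\mathbb{Z}_\infty,\min,+)$. WFA. A $(\min,+)$ weighted finite automaton (WFA) is a tuple $\mathcal{A}=\langle Q,\Sigma,Q_0,\Delta,F\rangle$ with $Q$ a finite set of states, $\Sigma$ a finite alphabet, $Q_0\subseteq Q$ a set of initial states, $F\subseteq Q$ the accepting states, and $\Delta\subseteq Q\times\Sigma\times\mathbb{Z}_\infty\times Q$ such that for every $p,q\in Q$, $\sigma\in\Sigma$ there is exactly one $c\in\mathbb{Z}_\infty$ with $(p,\sigma,c,q)\in\Delta$ (weight $\infty$ means the transition is absent). A run on a word is a sequence of consecutive transitions of finite weight reading the word; its weight is the sum of its transition weights; it is accepting if it starts in $Q_0$ and ends in $F$. The function represented is $w\mapsto\mathcal{A}(w)$, the minimal weight of an accepting run on $w$ ($\infty$ if none). The width of $\mathcal{A}$ is the maximum over $w\in\Sigma^*$ of the number of states $q$ for which there is a run on $w$ from some state of $Q_0$ to $q$. CRA. A (tropical) cost register automaton with linear register updates of dimension $k$ ($k$-CRA) is a tuple $\mathcal{N}=\langle Q,\Sigma,\delta,q_0,F,\mathtt{upd},\mathtt{fin}\rangle$ where $\langle Q,\Sigma,\delta,q_0,F\rangle$ is a deterministic finite automaton with transition function $\delta:Q\times\Sigma\to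 Q$; for each $q\in Q,\sigma\in\Sigma$, $\mathtt{upd}(q,\sigma)$ is a $k\times k$ matrix over $\mathbb{Z}_\infty$; and for each $q\in F$, $\mathtt{fin}(q)\subseteq[k]$. For $w=\sigma_1\cdots\sigma_n$ with DFA run $q_0,\ldots,q_n$, define row vectors $r^0=(0,\ldots,0)$ and $r^{i+1}=r^i\cdot\mathtt{upd}(q_i,\sigma_{i+1})$, i.e. $r^{i+1}_j=\min_{l\in[k]}\bigl(r^i_l+\mathtt{upd}(q_i,\sigma_{i+1})_{l,j}\bigr)$. The function represented maps $w$ to $\min\{r^n_i\mid i\in\mathtt{fin}(q_n)\}$ if $q_n\in F$ (with $\min\emptyset=\infty$), and to $\infty$ if $q_n\notin F$. *)

theory Defs
  imports "HOL-Library.Extended_Nat" "HOL-Library.FuncSet"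
begin

datatype zinf = Fin int | Infty

instantiation zinf :: infinity
begin
definition infinity_zinf :: zinf where "\<infinity> = Infty"
instance ..
end

instantiation zinf :: linorder
begin

fun less_eq_zinf :: "zinf \<Rightarrow> zinf \<Rightarrow> bool" where
  "Fin a \<le> Fin b \<longleftrightarrow> a \<le> b"
| "x \<le> Infty \<longleftrightarrow> True"
| "Infty \<le> Fin b \<longleftrightarrow> False"

definition less_zinf :: "zinf \<Rightarrow> zinf \<Rightarrow> bool" where
  "x < y \<longleftrightarrow> x \<le> y \<and> \<not> y \<le> (x :: zinf)"

instance
proof
  fix x y z :: zinf
  show "x < y \<longleftrightarrow> x \<le> y \<and> \<not> y \<le> x" by (rule less_zinf_def)
  show "x \<le> x" by (cases x) auto
  show "x \<le> y \<Longrightarrow> y \<le> z \<Longrightarrow> x \<le> z" by (cases x; cases y; cases z) auto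
  show "x \<le> y \<Longrightarrow> y \<le> x \<Longrightarrow> x = y" by (cases x; cases y) auto
  show "x \<le> y \<or> y \<le> x" by (cases x; cases y) auto
qed

end

instantiation zinf :: comm_monoid_add
begin

definition zero_zinf :: zinf where "0 = Fin 0"

fun plus_zinf :: "zinf \<Rightarrow> zinf \<Rightarrow> zinf" where
  "Fin a + Fin b = Fin (a + b)"
| "x + Infty = Infty"
| "Infty + Fin b = Infty"

instance
proof
  fix x y z :: zinf
  show "x + y + z = x + (y + z)" by (cases x; cases y; cases z) auto
  show "x + y = y + x" by (cases x; cases y) auto
  show "0 + x = x" by (cases x) (auto simp: zero_zinf_def)
qed

end

text \<open>Minimum of a finite set, with the convention that the empty set has minimum \<open>\<infinity>\<close>.
  All sets it is applied to below are finite.\<close>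

definition min_inf :: "zinf set \<Rightarrow> zinf" where
  "min_inf S = Min (insert \<infinity> S)"


section \<open>Weighted finite automata\<close>

type_synonym ('q, 'a) transition = "'q \<times> 'a \<times> zinf \<times> 'q"

record ('q, 'a) wfa =
  wstates :: "'q set"
  walphabet :: "'a set"
  winit :: "'q set"
  wtrans :: "('q, 'a) transition set"
  wfinal :: "'q set"

definition is_wfa :: "('q, 'a) wfa \<Rightarrow> bool" where
  "is_wfa A \<longleftrightarrow> finite (wstates A) \<and> finite (walphabet A) \<and>
     winit A \<subseteq> wstates A \<and> wfinal A \<subseteq> wstates A \<and>
     wtrans A \<subseteq> wstates A \<times> walphabet A \<times> UNIV \<times> wstates A \<and>
     (\<forall>p\<in>wstates A. \<forall>q\<in>wstates A. \<forall>a\<in>walphabet A. \<exists>!c. (p, a, c, q) \<in> wtrans A)"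

text \<open>Sequences of consecutive transitions of finite weight.\<close>

fun path :: "('q, 'a) wfa \<Rightarrow> 'q \<Rightarrow> ('q, 'a) transition list \<Rightarrow> 'q \<Rightarrow> bool" where
  "path A p [] q \<longleftrightarrow> p \<in> wstates A \<and> p = q"
| "path A p ((p', a, c, r) # ts) q \<longleftrightarrow>
     p' = p \<and> (p, a, c, r) \<in> wtrans A \<and> c \<noteq> \<infinity> \<and> path A r ts q"

definition path_word :: "('q, 'a) transition list \<Rightarrow> 'a list" where
  "path_word ts = map (\<lambda>(p, a, c, q). a) ts"

definition path_weight :: "('q, 'a) transition list \<Rightarrow> zinf" where
  "path_weight ts = (\<Sum>(p, a, c, q)\<leftarrow>ts. c)"

definition is_run :: "('q, 'a) wfa \<Rightarrow> 'a list \<Rightarrow> 'q \<Rightarrow> ('q, 'a) transition list \<Rightarrow> 'q \<Rightarrow> bool" where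
  "is_run A w p ts q \<longleftrightarrow> path A p ts q \<and> path_word ts = w"

definition wfa_value :: "('q, 'a) wfa \<Rightarrow> 'a list \<Rightarrow> zinf" where
  "wfa_value A w =
     min_inf {path_weight ts | p ts q. p \<in> winit A \<and> q \<in> wfinal A \<and> is_run A w p ts q}"

definition reach :: "('q, 'a) wfa \<Rightarrow> 'a list \<Rightarrow> 'q set" where
  "reach A w = {q. \<exists>p\<in>winit A. \<exists>ts. is_run A w p ts q}"

definition width :: "('q, 'a) wfa \<Rightarrow> nat" where
  "width A = Max {card (reach A w) | w. w \<in> lists (walphabet A)}"


section \<open>Cost register automata\<close>

text \<open>Registers are indexed by \<open>{1..k}\<close>; a \<open>k \<times> k\<close> matrix is a function of a row and a column
  index of which only the values on \<open>{1..k}\<close> matter, and likewise for row vectors.\<close>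

type_synonym matrix = "nat \<Rightarrow> nat \<Rightarrow> zinf"
type_synonym row_vector = "nat \<Rightarrow> zinf"

definition vec_mat :: "nat \<Rightarrow> row_vector \<Rightarrow> matrix \<Rightarrow> row_vector" where
  "vec_mat k r M = (\<lambda>j. min_inf {r l + M l j | l. l \<in> {1..k}})"

record ('q, 'a) cra =
  cstates :: "'q set"
  calphabet :: "'a set"
  cdelta :: "'q \<Rightarrow> 'a \<Rightarrow> 'q"
  cinit :: 'q
  cfinal :: "'q set"
  cupd :: "'q \<Rightarrow> 'a \<Rightarrow> matrix"
  cfin :: "'q \<Rightarrow> nat set"

definition is_cra :: "nat \<Rightarrow> ('q, 'a) cra \<Rightarrow> bool" where
  "is_cra k N \<longleftrightarrow> finite (cstates N) \<and> finite (calphabet N) \<and>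
     cinit N \<in> cstates N \<and> cfinal N \<subseteq> cstates N \<and>
     (\<forall>q\<in>cstates N. \<forall>a\<in>calphabet N. cdelta N q a \<in> cstates N) \<and>
     (\<forall>q\<in>cfinal N. cfin N q \<subseteq> {1..k})"

definition cra_step :: "nat \<Rightarrow> ('q, 'a) cra \<Rightarrow> 'q \<times> row_vector \<Rightarrow> 'a \<Rightarrow> 'q \<times> row_vector" where
  "cra_step k N = (\<lambda>(q, r) a. (cdelta N q a, vec_mat k r (cupd N q a)))"

definition cra_config :: "nat \<Rightarrow> ('q, 'a) cra \<Rightarrow> 'a list \<Rightarrow> 'q \<times> row_vector" where
  "cra_config k N w = foldl (cra_step k N) (cinit N, \<lambda>_. 0) w"

definition cra_value :: "nat \<Rightarrow> ('q, 'a) cra \<Rightarrow> 'a list \<Rightarrow> zinf" where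
  "cra_value k N w =
     (case cra_config k N w of (q, r) \<Rightarrow> if q \<in> cfinal N then min_inf (r ` cfin N q) else \<infinity>)"


section \<open>Classes of represented functions\<close>

text \<open>Functions on words over \<open>\<Sigma>\<close> are extensional on \<open>lists \<Sigma>\<close>. State sets are finite sets of
  natural numbers; the lemmas at the end show that admitting state sets in an arbitrary type
  yields no further functions.\<close>

definition cra_functions :: "nat \<Rightarrow> 'a set \<Rightarrow> ('a list \<Rightarrow> zinf) set" where
  "cra_functions k \<Sigma> = {restrict (cra_value k N) (lists \<Sigma>) | N :: (nat, 'a) cra.
     is_cra k N \<and> calphabet N = \<Sigma>}"

definition wfa_functions :: "nat \<Rightarrow> 'a set \<Rightarrow> ('a list \<Rightarrow> zinf) set" where
  "wfa_functions k \<Sigma> = {restrict (wfa_value A) (lists \<Sigma>) | A :: (nat, 'a) wfa.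
     is_wfa A \<and> walphabet A = \<Sigma> \<and> width A = k}"


subsection \<open>Independence of the type of states\<close>

definition rename_cra :: "('q \<Rightarrow> 'p) \<Rightarrow> ('q, 'a) cra \<Rightarrow> ('p, 'a) cra" where
  "rename_cra h N = (let g = inv_into (cstates N) h in
     \<lparr>cstates = h ` cstates N, calphabet = calphabet N, cdelta = \<lambda>q a. h (cdelta N (g q) a),
      cinit = h (cinit N), cfinal = h ` cfinal N, cupd = \<lambda>q. cupd N (g q), cfin = \<lambda>q. cfin N (g q)\<rparr>)"

lemma is_cra_rename:
  assumes "is_cra k N" "inj_on h (cstates N)"
  shows "is_cra k (rename_cra h N)"
proof -
  have "x \<in> cstates N" if "x \<in> cfinal N" for x using assms(1) that by (auto simp: is_cra_def)
  then show ?thesis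
    using assms by (auto simp: is_cra_def rename_cra_def Let_def)
qed

lemma cra_config_rename:
  assumes "is_cra k N" "inj_on h (cstates N)" "w \<in> lists (calphabet N)"
  shows "fst (cra_config k N w) \<in> cstates N \<and>
    cra_config k (rename_cra h N) w = map_prod h id (cra_config k N w)"
  using assms(3)
proof (induction w rule: rev_induct)
  case Nil
  then show ?case using assms by (auto simp: cra_config_def is_cra_def rename_cra_def Let_def)
next
  case (snoc a w)
  obtain q r where qr: "cra_config k N w = (q, r)" by fastforce
  with snoc have q: "q \<in> cstates N" "a \<in> calphabet N" 
    and *: "cra_config k (rename_cra h N) w = (h q, r)" by auto
  have "cdelta N q a \<in> cstates N" using assms(1) q by (auto simp: is_cra_def)
  then show ?case using qr * q assms(2)
    by (auto simp: cra_config_def cra_step_def rename_cra_def Let_def)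
qed

lemma cra_value_rename:
  assumes "is_cra k N" "inj_on h (cstates N)" "w \<in> lists (calphabet N)"
  shows "cra_value k (rename_cra h N) w = cra_value k N w"
proof -
  obtain q r where qr: "cra_config k N w = (q, r)" by fastforce
  have q: "q \<in> cstates N" and *: "cra_config k (rename_cra h N) w = (h q, r)"
    using cra_config_rename[OF assms] qr by auto
  have "h q \<in> h ` cfinal N \<longleftrightarrow> q \<in> cfinal N"
    using q assms(1,2) by (auto simp: is_cra_def inj_on_def)
  then show ?thesis using qr * q assms(2)
    by (auto simp: cra_value_def rename_cra_def Let_def)
qed

lemma cra_value_in_cra_functions:
  fixes N :: "('q, 'a) cra"
  assumes "is_cra k N"
  shows "restrict (cra_value k N) (lists (calphabet N)) \<in> cra_functions k (calphabet N)"
proof -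
  obtain h :: "'q \<Rightarrow> nat" where h: "inj_on h (cstates N)"
    using assms finite_imp_inj_to_nat_seg unfolding is_cra_def by metis
  have "restrict (cra_value k N) (lists (calphabet N)) =
    restrict (cra_value k (rename_cra h N)) (lists (calphabet N))"
    using cra_value_rename[OF assms h] by (auto simp: restrict_def fun_eq_iff)
  moreover have "calphabet (rename_cra h N) = calphabet N"
    by (simp add: rename_cra_def Let_def)
  ultimately show ?thesis using is_cra_rename[OF assms h]
    unfolding cra_functions_def by blast
qed

definition rename_transition :: "('q \<Rightarrow> 'p) \<Rightarrow> ('q, 'a) transition \<Rightarrow> ('p, 'a) transition" where
  "rename_transition h = (\<lambda>(p, a, c, q). (h p, a, c, h q))"

definition rename_wfa :: "('q \<Rightarrow> 'p) \<Rightarrow> ('q, 'a) wfa \<Rightarrow> ('p, 'a) wfa" where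
  "rename_wfa h A =
     \<lparr>wstates = h ` wstates A, walphabet = walphabet A, winit = h ` winit A,
      wtrans = rename_transition h ` wtrans A, wfinal = h ` wfinal A\<rparr>"

lemma rename_wfa_simps [simp]:
  "wstates (rename_wfa h A) = h ` wstates A"
  "walphabet (rename_wfa h A) = walphabet A"
  "winit (rename_wfa h A) = h ` winit A"
  "wtrans (rename_wfa h A) = rename_transition h ` wtrans A"
  "wfinal (rename_wfa h A) = h ` wfinal A"
  by (simp_all add: rename_wfa_def)

lemma wtrans_rename:
  assumes "is_wfa A" "inj_on h (wstates A)" "p \<in> wstates A" "q \<in> wstates A"
  shows "(h p, a, c, h q) \<in> rename_transition h ` wtrans A \<longleftrightarrow> (p, a, c, q) \<in> wtrans A"
proof
  assume "(h p, a, c, h q) \<in> rename_transition h ` wtrans A"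
  then obtain p' q' where *: "(p', a, c, q') \<in> wtrans A" "h p' = h p" "h q' = h q"
    by (auto simp: rename_transition_def)
  moreover from * have "p' \<in> wstates A" "q' \<in> wstates A"
    using assms(1) by (auto simp: is_wfa_def)
  ultimately show "(p, a, c, q) \<in> wtrans A" using assms(2-4) by (metis inj_onD)
qed (force simp: rename_transition_def)

lemma is_wfa_rename:
  assumes "is_wfa A" "inj_on h (wstates A)"
  shows "is_wfa (rename_wfa h A)"
proof -
  have "rename_transition h ` wtrans A \<subseteq> h ` wstates A \<times> walphabet A \<times> UNIV \<times> h ` wstates A"
  proof
    fix t assume "t \<in> rename_transition h ` wtrans A"
    then obtain p a c q where t: "(p, a, c, q) \<in> wtrans A" "t = (h p, a, c, h q)"
      by (auto simp: rename_transition_def)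
    then have "p \<in> wstates A" "a \<in> walphabet A" "q \<in> wstates A"
      using assms(1) by (auto simp: is_wfa_def)
    with t(2) show "t \<in> h ` wstates A \<times> walphabet A \<times> UNIV \<times> h ` wstates A" by simp
  qed
  moreover have "\<exists>!c. (h p, a, c, h q) \<in> rename_transition h ` wtrans A"
    if "p \<in> wstates A" "q \<in> wstates A" "a \<in> walphabet A" for p q a
    unfolding wtrans_rename[OF assms that(1,2)] using assms(1) that by (simp add: is_wfa_def)
  ultimately show ?thesis
    using assms(1) unfolding is_wfa_def rename_wfa_simps ball_simps(9) by (simp add: image_mono)
qed

lemma path_rename:
  assumes "is_wfa A" "inj_on h (wstates A)" "p \<in> wstates A"
  shows "path (rename_wfa h A) (h p) us q' \<longleftrightarrow>
    (\<exists>ts q. path A p ts q \<and> q \<in> wstates A \<and> q' = h q \<and> us = map (rename_transition h) ts)"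
  using assms(3)
proof (induction us arbitrary: p)
  case Nil
  then show ?case by auto
next
  case (Cons u us)
  obtain x a c y where u: "u = (x, a, c, y)" by (cases u)
  show ?case
  proof
    assume *: "path (rename_wfa h A) (h p) (u # us) q'"
    then have "(h p, a, c, y) \<in> rename_transition h ` wtrans A" by (simp add: u)
    then obtain r where r: "y = h r" "r \<in> wstates A"
      using assms(1) by (fastforce simp: rename_transition_def is_wfa_def)
    then have t: "(p, a, c, r) \<in> wtrans A"
      using * wtrans_rename[OF assms(1,2) Cons.prems r(2)] by (simp add: u)
    have "path (rename_wfa h A) (h r) us q'" using * r by (simp add: u)
    then obtain ts q where "path A r ts q" "q \<in> wstates A" "q' = h q"
      "us = map (rename_transition h) ts" using Cons.IH[OF r(2)] by blast
    moreover have "c \<noteq> \<infinity>" using * by (simp add: u)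
    moreover have "x = h p" using * by (simp add: u)
    ultimately have "path A p ((p, a, c, r) # ts) q \<and> q \<in> wstates A \<and> q' = h q \<and>
        u # us = map (rename_transition h) ((p, a, c, r) # ts)"
      using t r(1) by (simp add: u rename_transition_def)
    then show "\<exists>ts q. path A p ts q \<and> q \<in> wstates A \<and> q' = h q \<and>
        u # us = map (rename_transition h) ts" by (intro exI)
  next
    assume "\<exists>ts q. path A p ts q \<and> q \<in> wstates A \<and> q' = h q \<and>
        u # us = map (rename_transition h) ts"
    then obtain ts' q where ts': "path A p ts' q" "q \<in> wstates A" "q' = h q"
      "u # us = map (rename_transition h) ts'" by (elim exE conjE)
    then obtain t ts where "ts' = t # ts" by (cases ts') simp_all
    with ts' have *: "path A p (t # ts) q" "q \<in> wstates A" "q' = h q"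
      "u = rename_transition h t" "us = map (rename_transition h) ts" by simp_all
    obtain r where t: "t = (p, a, c, r)" "y = h r" "x = h p"
      using * u by (cases t) (auto simp: rename_transition_def)
    then have "(p, a, c, r) \<in> wtrans A" "c \<noteq> \<infinity>" "path A r ts q" using * by auto
    moreover from this have r: "r \<in> wstates A" using assms(1) by (auto simp: is_wfa_def)
    moreover have "path (rename_wfa h A) (h r) us q'"
      unfolding Cons.IH[OF r] using * calculation(3) by (intro exI conjI)
    ultimately show "path (rename_wfa h A) (h p) (u # us) q'"
      using wtrans_rename[OF assms(1,2) Cons.prems r] by (simp add: u t)
  qed
qed

lemma path_rename_list [simp]:
  "path_word (map (rename_transition h) ts) = path_word ts"
  "path_weight (map (rename_transition h) ts) = path_weight ts"
  by (induction ts) (auto simp: path_word_def path_weight_def rename_transition_def)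

lemma is_run_rename:
  assumes "is_wfa A" "inj_on h (wstates A)" "p \<in> wstates A"
  shows "is_run (rename_wfa h A) w (h p) us q' \<longleftrightarrow>
    (\<exists>ts q. is_run A w p ts q \<and> q \<in> wstates A \<and> q' = h q \<and> us = map (rename_transition h) ts)"
proof
  assume "is_run (rename_wfa h A) w (h p) us q'"
  then have "path (rename_wfa h A) (h p) us q'" and w: "path_word us = w"
    by (simp_all add: is_run_def)
  then obtain ts q where ts: "path A p ts q" "q \<in> wstates A" "q' = h q"
    "us = map (rename_transition h) ts" unfolding path_rename[OF assms] by (elim exE conjE)
  then have "is_run A w p ts q" using w by (simp add: is_run_def)
  with ts show "\<exists>ts q. is_run A w p ts q \<and> q \<in> wstates A \<and> q' = h q \<and>
      us = map (rename_transition h) ts" by (intro exI conjI)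
next
  assume "\<exists>ts q. is_run A w p ts q \<and> q \<in> wstates A \<and> q' = h q \<and>
      us = map (rename_transition h) ts"
  then obtain ts q where ts: "is_run A w p ts q" "q \<in> wstates A" "q' = h q"
    "us = map (rename_transition h) ts" by (elim exE conjE)
  then have "path A p ts q" "path_word us = w" by (simp_all add: is_run_def)
  moreover from this ts have "path (rename_wfa h A) (h p) us q'"
    unfolding path_rename[OF assms] by (intro exI conjI)
  ultimately show "is_run (rename_wfa h A) w (h p) us q'" by (simp add: is_run_def)
qed

lemma is_run_wstates:
  assumes "is_wfa A" "is_run A w p ts q"
  shows "p \<in> wstates A" "q \<in> wstates A"
proof -
  have "path A p ts q" using assms(2) by (simp add: is_run_def)
  then have "p \<in> wstates A \<and> q \<in> wstates A"
  proof (induction ts arbitrary: p)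
    case (Cons t ts)
    then show ?case using assms(1) by (cases t) (auto simp: is_wfa_def)
  qed simp
  then show "p \<in> wstates A" "q \<in> wstates A" by auto
qed

lemma wfa_value_rename:
  assumes "is_wfa A" "inj_on h (wstates A)"
  shows "wfa_value (rename_wfa h A) w = wfa_value A w"
proof -
  have sub: "winit A \<subseteq> wstates A" "wfinal A \<subseteq> wstates A" using assms(1) by (auto simp: is_wfa_def)
  have "{path_weight us | p' us q'. p' \<in> h ` winit A \<and> q' \<in> h ` wfinal A \<and>
           is_run (rename_wfa h A) w p' us q'} =
        {path_weight ts | p ts q. p \<in> winit A \<and> q \<in> wfinal A \<and> is_run A w p ts q}" (is "?L = ?R")
  proof (intro set_eqI iffI)
    fix x assume "x \<in> ?L"
    then obtain p us q where *: "x = path_weight us" "p \<in> winit A" "q \<in> wfinal A"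
      "is_run (rename_wfa h A) w (h p) us (h q)" by auto
    have p: "p \<in> wstates A" using * sub by auto
    obtain ts q2 where **: "is_run A w p ts q2" "q2 \<in> wstates A" "h q = h q2"
      "us = map (rename_transition h) ts"
      using *(4) unfolding is_run_rename[OF assms p] by (elim exE conjE)
    have "q \<in> wstates A" using * sub by auto
    with **(2,3) have "q = q2" by (intro inj_onD[OF assms(2)])
    then have "x = path_weight ts \<and> p \<in> winit A \<and> q \<in> wfinal A \<and> is_run A w p ts q"
      using *(1-3) **(1,4) by simp
    then show "x \<in> ?R" unfolding mem_Collect_eq by (intro exI)
  next
    fix x assume "x \<in> ?R"
    then obtain p ts q where *: "x = path_weight ts" "p \<in> winit A" "q \<in> wfinal A"
      "is_run A w p ts q" by auto
    have p: "p \<in> wstates A" "q \<in> wstates A" using * sub by auto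
    have "is_run (rename_wfa h A) w (h p) (map (rename_transition h) ts) (h q)"
      unfolding is_run_rename[OF assms p(1)] using *(4) p(2) by (intro exI conjI) (assumption | rule refl)+
    then have "x = path_weight (map (rename_transition h) ts) \<and> h p \<in> h ` winit A \<and>
      h q \<in> h ` wfinal A \<and> is_run (rename_wfa h A) w (h p) (map (rename_transition h) ts) (h q)"
      using * by simp
    then show "x \<in> ?L" unfolding mem_Collect_eq by (intro exI)
  qed
  then show ?thesis by (simp add: wfa_value_def)
qed

lemma reach_rename:
  assumes "is_wfa A" "inj_on h (wstates A)"
  shows "reach (rename_wfa h A) w = h ` reach A w"
proof -
  have sub: "p \<in> wstates A" if "p \<in> winit A" for p
    using assms(1) that by (auto simp: is_wfa_def)
  show ?thesis
  proof (intro set_eqI iffI)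
    fix y assume "y \<in> reach (rename_wfa h A) w"
    then obtain p us where *: "p \<in> winit A" "is_run (rename_wfa h A) w (h p) us y"
      by (auto simp: reach_def)
    obtain ts q where **: "is_run A w p ts q" "y = h q"
      using *(2) unfolding is_run_rename[OF assms sub[OF *(1)]] by (elim exE conjE)
    then have "q \<in> reach A w" using *(1) unfolding reach_def by blast
    with **(2) show "y \<in> h ` reach A w" by simp
  next
    fix y assume "y \<in> h ` reach A w"
    then obtain p ts q where *: "p \<in> winit A" "is_run A w p ts q" "y = h q"
      by (auto simp: reach_def)
    have "is_run (rename_wfa h A) w (h p) (map (rename_transition h) ts) y"
      unfolding is_run_rename[OF assms sub[OF *(1)]]
      using *(2,3) is_run_wstates(2)[OF assms(1) *(2)] by (intro exI conjI) (assumption | rule refl)+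
    with *(1) show "y \<in> reach (rename_wfa h A) w" unfolding reach_def by auto
  qed
qed

lemma width_rename:
  assumes "is_wfa A" "inj_on h (wstates A)"
  shows "width (rename_wfa h A) = width A"
proof -
  have "card (h ` reach A w) = card (reach A w)" for w
    using is_run_wstates[OF assms(1)]
    by (intro card_image inj_on_subset[OF assms(2)]) (auto simp: reach_def)
  then show ?thesis by (simp add: width_def reach_rename[OF assms])
qed

lemma wfa_value_in_wfa_functions:
  fixes A :: "('q, 'a) wfa"
  assumes "is_wfa A"
  shows "restrict (wfa_value A) (lists (walphabet A)) \<in> wfa_functions (width A) (walphabet A)"
proof -
  obtain h :: "'q \<Rightarrow> nat" where h: "inj_on h (wstates A)"
    using assms finite_imp_inj_to_nat_seg unfolding is_wfa_def by metis
  have "wfa_value A = wfa_value (rename_wfa h A)"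
    using wfa_value_rename[OF assms h] by (simp add: fun_eq_iff)
  moreover have "walphabet (rename_wfa h A) = walphabet A" by simp
  ultimately show ?thesis using is_wfa_rename[OF assms h] width_rename[OF assms h]
    unfolding wfa_functions_def mem_Collect_eq
    by (intro exI[of _ "rename_wfa h A"] conjI) simp_all
qed

end

(* Both models are compared through the vector of minimal weights of runs reaching each state.
   A k-CRA becomes a WFA on the pairs (q, i) of a state and a register: after reading w only the
   pairs with q the current DFA state are reachable, register i holds the weight of (q, i), and all
   k pairs over the initial state are initial, so the width is exactly k.
   Conversely the reachable sets of a WFA of width k are the states of a deterministic automaton,
   and the elements of each such set are numbered by registers; a register that numbers no state
   contains junk (initially 0), which the updates mask by weight infinity. *)

theory Submission
  imports Defs
begin

section \<open>Order and addition with infinity, and lower bounds of finite minima\<close>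

lemma zinf_le_infinity [simp]: "(x :: zinf) \<le> \<infinity>"
  by (cases x) (auto simp: infinity_zinf_def)

lemma infinity_le_zinf_iff [simp]: "\<infinity> \<le> (x :: zinf) \<longleftrightarrow> x = \<infinity>"
  by (cases x) (auto simp: infinity_zinf_def)

lemma zinf_add_infinity [simp]: "(x :: zinf) + \<infinity> = \<infinity>" "\<infinity> + (x :: zinf) = \<infinity>"
  by (cases x; simp add: infinity_zinf_def)+

lemma zinf_add_eq_infinity_iff: "(x :: zinf) + y = \<infinity> \<longleftrightarrow> x = \<infinity> \<or> y = \<infinity>"
  by (cases x; cases y) (auto simp: infinity_zinf_def)

lemma zero_zinf_neq_infinity [simp]: "(0 :: zinf) \<noteq> \<infinity>"
  by (simp add: infinity_zinf_def zero_zinf_def)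

lemma zinf_add_right_mono: "(x :: zinf) \<le> y \<Longrightarrow> x + z \<le> y + z"
  by (cases x; cases y; cases z) auto

text \<open>In a partial order an element is determined by its lower bounds. All equalities of
  weights below are proved this way, so that minima turn into universal quantifiers.\<close>

lemma zinf_eqI:
  fixes x y :: zinf
  assumes "\<And>z. z \<le> x \<longleftrightarrow> z \<le> y"
  shows "x = y"
  using assms by (meson order_antisym order_refl)

lemma min_inf_mem:
  assumes "finite S"
  shows "min_inf S \<in> insert \<infinity> S"
  unfolding min_inf_def using assms by (intro Min_in) auto

lemma le_min_inf_iff:
  assumes "finite S"
  shows "x \<le> min_inf S \<longleftrightarrow> (\<forall>s\<in>S. x \<le> s)"
  unfolding min_inf_def using assms by simp

text \<open>Addition distributes over the minimum: it is monotone, and the minimum is either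
  attained or \<open>\<infinity>\<close>, which absorbs \<open>c\<close>. The second case covers the
  empty set.\<close>

lemma le_min_inf_add_iff:
  assumes "finite S"
  shows "x \<le> min_inf S + c \<longleftrightarrow> (\<forall>s\<in>S. x \<le> s + c)"
proof
  assume "x \<le> min_inf S + c"
  moreover have "min_inf S + c \<le> s + c" if "s \<in> S" for s
    using le_min_inf_iff[OF assms, of "min_inf S"] that by (intro zinf_add_right_mono) auto
  ultimately show "\<forall>s\<in>S. x \<le> s + c" using order_trans by blast
qed (use min_inf_mem[OF assms] in auto)

lemma le_vec_mat_iff: "x \<le> vec_mat k r M j \<longleftrightarrow> (\<forall>l\<in>{1..k}. x \<le> r l + M l j)"
proof -
  have "{r l + M l j | l. l \<in> {1..k}} = (\<lambda>l. r l + M l j) ` {1..k}" by auto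
  then show ?thesis by (simp add: vec_mat_def le_min_inf_iff)
qed


section \<open>Minimal weights of runs\<close>

text \<open>The description is meaningful only for states and letters of \<open>A\<close>; elsewhere
  its value is unspecified.\<close>

definition trans_weight :: "('q, 'a) wfa \<Rightarrow> 'q \<Rightarrow> 'a \<Rightarrow> 'q \<Rightarrow> zinf" where
  "trans_weight A p a q = (THE c. (p, a, c, q) \<in> wtrans A)"

text \<open>Final states are ignored, so these weights obey a recursion in the last letter and can
  be matched with register contents.\<close>

definition reach_weight :: "('q, 'a) wfa \<Rightarrow> 'a list \<Rightarrow> 'q \<Rightarrow> zinf" where
  "reach_weight A w q = min_inf {path_weight ts | p ts. p \<in> winit A \<and> is_run A w p ts q}"

lemma wtrans_iff:
  assumes "is_wfa A"
  shows "(p, a, c, q) \<in> wtrans A \<longleftrightarrow>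
    p \<in> wstates A \<and> q \<in> wstates A \<and> a \<in> walphabet A \<and> c = trans_weight A p a q"
proof (cases "p \<in> wstates A \<and> q \<in> wstates A \<and> a \<in> walphabet A")
  case True
  then have "\<exists>!c. (p, a, c, q) \<in> wtrans A" using assms by (simp add: is_wfa_def)
  then show ?thesis using True theI'[of "\<lambda>c. (p, a, c, q) \<in> wtrans A"]
    unfolding trans_weight_def by metis
next
  case False
  then show ?thesis using assms by (auto simp: is_wfa_def)
qed

text \<open>Infinitely many weights are possible, but uniqueness makes each transition a function of
  its two states and its letter.\<close>

lemma finite_wtrans:
  assumes "is_wfa A"
  shows "finite (wtrans A)"
proof (rule finite_subset)
  show "wtrans A \<subseteq> (\<lambda>(p, a, q). (p, a, trans_weight A p a q, q)) `
      (wstates A \<times> walphabet A \<times> wstates A)"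
    using wtrans_iff[OF assms] by (force simp: image_iff)
qed (use assms in \<open>auto simp: is_wfa_def\<close>)

lemma path_subset_wtrans: "path A p ts q \<Longrightarrow> set ts \<subseteq> wtrans A"
  by (induction A p ts q rule: path.induct) auto

text \<open>A run on \<open>w\<close> is a list of length \<open>length w\<close> over a finite set.
  This gives the finiteness that minima over runs need.\<close>

lemma finite_runs:
  assumes "is_wfa A"
  shows "finite {ts. \<exists>p q. is_run A w p ts q}"
proof (rule finite_subset)
  show "{ts. \<exists>p q. is_run A w p ts q} \<subseteq> {ts. set ts \<subseteq> wtrans A \<and> length ts = length w}"
    by (auto simp: is_run_def path_word_def dest: path_subset_wtrans)
  show "finite {ts. set ts \<subseteq> wtrans A \<and> length ts = length w}"
    by (intro finite_lists_length_eq finite_wtrans assms)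
qed

lemma finite_run_weights:
  assumes "is_wfa A"
  shows "finite {path_weight ts | p ts. p \<in> winit A \<and> is_run A w p ts q}"
    "finite {path_weight ts | p ts q. p \<in> winit A \<and> q \<in> wfinal A \<and> is_run A w p ts q}"
  by (rule finite_subset[OF _ finite_imageI[OF finite_runs[OF assms], of path_weight]], auto)+

lemma le_reach_weight_add_iff:
  assumes "is_wfa A"
  shows "x \<le> reach_weight A w q + c \<longleftrightarrow>
    (\<forall>p ts. p \<in> winit A \<longrightarrow> is_run A w p ts q \<longrightarrow> x \<le> path_weight ts + c)"
  unfolding reach_weight_def le_min_inf_add_iff[OF finite_run_weights(1)[OF assms]] by auto

lemma le_reach_weight_iff:
  assumes "is_wfa A"
  shows "x \<le> reach_weight A w q \<longleftrightarrow>
    (\<forall>p ts. p \<in> winit A \<longrightarrow> is_run A w p ts q \<longrightarrow> x \<le> path_weight ts)"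
  using le_reach_weight_add_iff[OF assms, where c = 0] by simp

lemma le_wfa_value_iff:
  assumes "is_wfa A"
  shows "x \<le> wfa_value A w \<longleftrightarrow> (\<forall>q\<in>wfinal A. x \<le> reach_weight A w q)"
  unfolding wfa_value_def le_min_inf_iff[OF finite_run_weights(2)[OF assms]]
    le_reach_weight_iff[OF assms] by blast

text \<open>\<open>path\<close> recurses at the front, whereas words are read off at the end. The
  empty path requires its endpoint to be a state, which holds for both ends of a transition of a
  WFA.\<close>

lemma path_snoc:
  assumes "is_wfa A"
  shows "path A p (ts @ [(p', a, c, r)]) q \<longleftrightarrow>
    path A p ts p' \<and> (p', a, c, r) \<in> wtrans A \<and> c \<noteq> \<infinity> \<and> r = q"
proof (induction ts arbitrary: p)
  case (Cons t ts)
  then show ?case by (cases t) auto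
qed (auto simp: wtrans_iff[OF assms])

lemma is_run_Nil: "is_run A [] p ts q \<longleftrightarrow> ts = [] \<and> p = q \<and> p \<in> wstates A"
  by (auto simp: is_run_def path_word_def)

lemma is_run_snoc:
  assumes "is_wfa A"
  shows "is_run A (w @ [a]) p us q \<longleftrightarrow>
    (\<exists>ts p'. us = ts @ [(p', a, trans_weight A p' a q, q)] \<and> is_run A w p ts p' \<and>
      p' \<in> wstates A \<and> q \<in> wstates A \<and> a \<in> walphabet A \<and> trans_weight A p' a q \<noteq> \<infinity>)"
    (is "_ \<longleftrightarrow> ?R")
proof
  assume run: "is_run A (w @ [a]) p us q"
  then obtain ts p' b c r where us: "us = ts @ [(p', b, c, r)]"
    by (cases us rule: rev_cases) (auto simp: is_run_def path_word_def)
  with run show ?R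
    by (auto simp: is_run_def path_word_def path_snoc[OF assms] wtrans_iff[OF assms])
next
  assume ?R
  then show "is_run A (w @ [a]) p us q"
    by (auto simp: is_run_def path_word_def path_snoc[OF assms] wtrans_iff[OF assms])
qed

lemma path_weight_snoc [simp]: "path_weight (ts @ [(p, a, c, q)]) = path_weight ts + c"
  by (simp add: path_weight_def)

lemma reach_weight_Nil:
  assumes "is_wfa A"
  shows "reach_weight A [] q = (if q \<in> winit A then 0 else \<infinity>)"
proof (rule zinf_eqI)
  have "q \<in> wstates A" if "q \<in> winit A" using assms that by (auto simp: is_wfa_def)
  then show "x \<le> reach_weight A [] q \<longleftrightarrow> x \<le> (if q \<in> winit A then 0 else \<infinity>)" for x
    by (auto simp: le_reach_weight_iff[OF assms] is_run_Nil path_weight_def)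
qed

text \<open>This is one vector-matrix product over (min,+), expressed by lower bounds: a run on
  \<open>w @ [a]\<close> is a run on \<open>w\<close> followed by one transition.\<close>

lemma le_reach_weight_snoc_iff:
  assumes "is_wfa A" "q \<in> wstates A" "a \<in> walphabet A"
  shows "x \<le> reach_weight A (w @ [a]) q \<longleftrightarrow>
    (\<forall>p\<in>wstates A. x \<le> reach_weight A w p + trans_weight A p a q)"
proof -
  have "x \<le> path_weight ts + trans_weight A p a q" if "trans_weight A p a q = \<infinity>" for ts p
    using that by simp
  then show ?thesis
    unfolding le_reach_weight_iff[OF assms(1)] le_reach_weight_add_iff[OF assms(1)]
      is_run_snoc[OF assms(1)] using assms(2,3) by (auto; metis path_weight_snoc)
qed

section \<open>Reachable sets and width\<close>

lemma run_weight_finite: "path A p ts q \<Longrightarrow> path_weight ts \<noteq> \<infinity>"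
  by (induction A p ts q rule: path.induct)
    (auto simp: path_weight_def zinf_add_eq_infinity_iff)

text \<open>Every run has finite weight, so the minimum is \<open>\<infinity>\<close> only when
  there is no run. Reachability can thus be read off the weight vector.\<close>

lemma mem_reach_iff:
  assumes "is_wfa A"
  shows "q \<in> reach A w \<longleftrightarrow> reach_weight A w q \<noteq> \<infinity>"
proof -
  have "reach_weight A w q = \<infinity> \<longleftrightarrow> (\<forall>p ts. p \<in> winit A \<longrightarrow> \<not> is_run A w p ts q)"
    using le_reach_weight_iff[OF assms, of \<infinity> w q] run_weight_finite[of A _ _ q]
    unfolding is_run_def infinity_le_zinf_iff by blast
  then show ?thesis by (auto simp: reach_def)
qed

lemma reach_subset_wstates:
  assumes "is_wfa A"
  shows "reach A w \<subseteq> wstates A"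
  using is_run_wstates[OF assms] by (auto simp: reach_def)

lemma reach_Nil:
  assumes "is_wfa A"
  shows "reach A [] = winit A"
  by (auto simp: mem_reach_iff[OF assms] reach_weight_Nil[OF assms] split: if_splits)

lemma finite_reach:
  assumes "is_wfa A"
  shows "finite (reach A w)"
  using assms reach_subset_wstates finite_subset unfolding is_wfa_def by metis

text \<open>Although there may be infinitely many words, the cardinalities are bounded by the number
  of states, so the \<open>Max\<close> in \<open>width\<close> is a genuine maximum.\<close>

lemma finite_reach_cards:
  assumes "is_wfa A"
  shows "finite {card (reach A w) | w. w \<in> lists (walphabet A)}"
proof (rule finite_subset)
  show "{card (reach A w) | w. w \<in> lists (walphabet A)} \<subseteq> {..card (wstates A)}"
    using assms reach_subset_wstates[OF assms] by (auto simp: is_wfa_def intro!: card_mono)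
qed simp

lemma card_reach_le_width:
  assumes "is_wfa A" "w \<in> lists (walphabet A)"
  shows "card (reach A w) \<le> width A"
  unfolding width_def using assms(2) by (intro Max_ge finite_reach_cards assms(1)) auto


section \<open>From cost register automata to weighted automata\<close>

lemma cra_config_Nil [simp]: "cra_config k N [] = (cinit N, \<lambda>_. 0)"
  by (simp add: cra_config_def)

lemma cra_config_snoc [simp]: "cra_config k N (w @ [a]) = cra_step k N (cra_config k N w) a"
  by (simp add: cra_config_def)

lemma le_cra_value_iff:
  assumes "is_cra k N" "cra_config k N w = (q, r)"
  shows "x \<le> cra_value k N w \<longleftrightarrow> (q \<in> cfinal N \<longrightarrow> (\<forall>i\<in>cfin N q. x \<le> r i))"
proof -
  have "finite (cfin N q)" if "q \<in> cfinal N"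
    using assms(1) that finite_subset[of _ "{1..k}"] by (auto simp: is_cra_def)
  then show ?thesis using assms(2) by (auto simp: cra_value_def le_min_inf_iff)
qed

text \<open>A WFA needs exactly one weight for each pair of states and letter, so moves that
  disagree with \<open>cdelta\<close> are listed with weight \<open>\<infinity>\<close>.\<close>

definition wfa_of_cra :: "nat \<Rightarrow> ('q, 'a) cra \<Rightarrow> ('q \<times> nat, 'a) wfa" where
  "wfa_of_cra k N =
     \<lparr>wstates = cstates N \<times> {1..k}, walphabet = calphabet N, winit = {cinit N} \<times> {1..k},
      wtrans = {((p, i), a, c, (q, j)) | p i a c q j.
        p \<in> cstates N \<and> q \<in> cstates N \<and> i \<in> {1..k} \<and> j \<in> {1..k} \<and> a \<in> calphabet N \<and>
        c = (if q = cdelta N p a then cupd N p a i j else \<infinity>)},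
      wfinal = (SIGMA q:cfinal N. cfin N q)\<rparr>"

lemma wfa_of_cra_simps [simp]:
  "wstates (wfa_of_cra k N) = cstates N \<times> {1..k}"
  "walphabet (wfa_of_cra k N) = calphabet N"
  "winit (wfa_of_cra k N) = {cinit N} \<times> {1..k}"
  "wfinal (wfa_of_cra k N) = (SIGMA q:cfinal N. cfin N q)"
  by (simp_all add: wfa_of_cra_def)

lemma is_wfa_wfa_of_cra:
  assumes "is_cra k N"
  shows "is_wfa (wfa_of_cra k N)"
proof -
  have "wfinal (wfa_of_cra k N) \<subseteq> wstates (wfa_of_cra k N)"
    using assms by (fastforce simp: is_cra_def)
  then show ?thesis using assms unfolding is_wfa_def by (auto simp: is_cra_def wfa_of_cra_def)
qed

lemma trans_weight_wfa_of_cra: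
  assumes "p \<in> cstates N" "q \<in> cstates N" "i \<in> {1..k}" "j \<in> {1..k}" "a \<in> calphabet N"
  shows "trans_weight (wfa_of_cra k N) (p, i) a (q, j) =
    (if q = cdelta N p a then cupd N p a i j else \<infinity>)"
  using assms unfolding trans_weight_def by (intro the_equality) (auto simp: wfa_of_cra_def)

text \<open>The invariant of the simulation, by induction on the last letter: the update matrix acts
  on the block of the current DFA state, and all other blocks carry
  \<open>\<infinity>\<close>.\<close>

lemma reach_weight_wfa_of_cra:
  assumes N: "is_cra k N" and "w \<in> lists (calphabet N)" "cra_config k N w = (q, r)"
  shows "q \<in> cstates N \<and> (\<forall>p\<in>cstates N. \<forall>i\<in>{1..k}.
    reach_weight (wfa_of_cra k N) w (p, i) = (if p = q then r i else \<infinity>))"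
  using assms(2,3)
proof (induction w arbitrary: q r rule: rev_induct)
  case Nil
  then show ?case using N by (auto simp: reach_weight_Nil is_wfa_wfa_of_cra is_cra_def)
next
  case (snoc a w)
  note A = is_wfa_wfa_of_cra[OF N]
  obtain q0 r0 where c: "cra_config k N w = (q0, r0)" by fastforce
  have a: "a \<in> calphabet N" and w: "w \<in> lists (calphabet N)" using snoc.prems by auto
  note IH = snoc.IH[OF w c]
  have q: "q = cdelta N q0 a" and r: "r = vec_mat k r0 (cupd N q0 a)"
    using snoc.prems(2) c by (simp_all add: cra_step_def)
  have qin: "q \<in> cstates N" using q a IH N by (auto simp: is_cra_def)
  have "reach_weight (wfa_of_cra k N) (w @ [a]) (p, i) = (if p = q then r i else \<infinity>)"
    if p: "p \<in> cstates N" "i \<in> {1..k}" for p i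
  proof (rule zinf_eqI)
    fix x
    have "x \<le> reach_weight (wfa_of_cra k N) (w @ [a]) (p, i) \<longleftrightarrow>
      (\<forall>p'\<in>cstates N. \<forall>l\<in>{1..k}. x \<le> (if p' = q0 then r0 l else \<infinity>) +
        (if p = cdelta N p' a then cupd N p' a l i else \<infinity>))"
      using le_reach_weight_snoc_iff[OF A, of "(p, i)" a x w] p a IH
      by (simp add: trans_weight_wfa_of_cra)
    \<comment> \<open>Only \<open>p' = q0\<close> yields a bound, and only if \<open>p\<close> is
      its successor \<open>q\<close>; what remains is the product defining
      \<open>r i\<close>.\<close>
    also have "\<dots> \<longleftrightarrow> x \<le> (if p = q then r i else \<infinity>)"
      using IH by (auto simp: q r le_vec_mat_iff)
    finally show "x \<le> reach_weight (wfa_of_cra k N) (w @ [a]) (p, i) \<longleftrightarrow>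
      x \<le> (if p = q then r i else \<infinity>)" .
  qed
  with qin show ?case by blast
qed

lemma wfa_value_wfa_of_cra:
  assumes N: "is_cra k N" and w: "w \<in> lists (calphabet N)"
  shows "wfa_value (wfa_of_cra k N) w = cra_value k N w"
proof (rule zinf_eqI)
  fix x
  obtain q r where c: "cra_config k N w = (q, r)" by fastforce
  have "x \<le> wfa_value (wfa_of_cra k N) w \<longleftrightarrow>
    (\<forall>p\<in>cfinal N. \<forall>i\<in>cfin N p. x \<le> reach_weight (wfa_of_cra k N) w (p, i))"
    by (simp add: le_wfa_value_iff is_wfa_wfa_of_cra[OF N])
  also have "\<dots> \<longleftrightarrow> (\<forall>p\<in>cfinal N. \<forall>i\<in>cfin N p. x \<le> (if p = q then r i else \<infinity>))"
  proof (intro ball_cong refl)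
    fix p i assume "p \<in> cfinal N" "i \<in> cfin N p"
    then have "p \<in> cstates N" "i \<in> {1..k}" using N unfolding is_cra_def by blast+
    then show "x \<le> reach_weight (wfa_of_cra k N) w (p, i) \<longleftrightarrow> x \<le> (if p = q then r i else \<infinity>)"
      using reach_weight_wfa_of_cra[OF N w c] by simp
  qed
  also have "\<dots> \<longleftrightarrow> x \<le> cra_value k N w"
    unfolding le_cra_value_iff[OF N c] by auto
  finally show "x \<le> wfa_value (wfa_of_cra k N) w \<longleftrightarrow> x \<le> cra_value k N w" .
qed

text \<open>The invariant confines each reachable set to the \<open>k\<close> pairs over one DFA
  state, and the empty word attains the bound since all \<open>k\<close> initial pairs count as
  reached.\<close>

lemma width_wfa_of_cra:
  assumes N: "is_cra k N"
  shows "width (wfa_of_cra k N) = k"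
proof -
  note A = is_wfa_wfa_of_cra[OF N]
  have "card (reach (wfa_of_cra k N) w) \<le> k" if w: "w \<in> lists (calphabet N)" for w
  proof -
    obtain q r where c: "cra_config k N w = (q, r)" by fastforce
    have "reach (wfa_of_cra k N) w \<subseteq> {q} \<times> {1..k}"
    proof
      fix s assume s: "s \<in> reach (wfa_of_cra k N) w"
      then have "s \<in> cstates N \<times> {1..k}" using reach_subset_wstates[OF A] by auto
      then show "s \<in> {q} \<times> {1..k}"
        using s reach_weight_wfa_of_cra[OF N w c] by (auto simp: mem_reach_iff[OF A] split: if_splits)
    qed
    then have "card (reach (wfa_of_cra k N) w) \<le> card ({q} \<times> {1..k})" by (intro card_mono) auto
    then show ?thesis by simp
  qed
  moreover have "card (reach (wfa_of_cra k N) []) = k"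
    by (simp add: reach_Nil[OF A])
  ultimately show ?thesis
    unfolding width_def using finite_reach_cards[OF A]
    by (intro Max_eqI) (auto intro!: exI[of _ "[]"])
qed


section \<open>From weighted automata to cost register automata\<close>

definition succ_states :: "('q, 'a) wfa \<Rightarrow> 'q set \<Rightarrow> 'a \<Rightarrow> 'q set" where
  "succ_states A S a = {q\<in>wstates A. \<exists>p\<in>S. trans_weight A p a q \<noteq> \<infinity>}"

text \<open>An arbitrary numbering that depends on the set alone, so all updates leading into the
  same set agree on the meaning of its registers.\<close>

definition state_index :: "'q set \<Rightarrow> 'q \<Rightarrow> nat" where
  "state_index S = (SOME f. bij_betw f S {1..card S})"

definition index_state :: "'q set \<Rightarrow> nat \<Rightarrow> 'q" where
  "index_state S = inv_into S (state_index S)"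

text \<open>Only sets that are actually reached serve as states, since their cardinality is bounded
  by the width. All of them are accepting: acceptance is left to \<open>cfin\<close>, and an empty
  \<open>cfin\<close> yields \<open>\<infinity>\<close>.\<close>

definition cra_of_wfa :: "('q, 'a) wfa \<Rightarrow> ('q set, 'a) cra" where
  "cra_of_wfa A =
     \<lparr>cstates = reach A ` lists (walphabet A), calphabet = walphabet A, cdelta = succ_states A,
      cinit = winit A, cfinal = reach A ` lists (walphabet A),
      cupd = (\<lambda>S a l j. if l \<in> {1..card S} \<and> j \<in> {1..card (succ_states A S a)}
        then trans_weight A (index_state S l) a (index_state (succ_states A S a) j) else \<infinity>),
      cfin = (\<lambda>S. state_index S ` (S \<inter> wfinal A))\<rparr>"

lemma cra_of_wfa_simps [simp]:
  "cstates (cra_of_wfa A) = reach A ` lists (walphabet A)"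
  "calphabet (cra_of_wfa A) = walphabet A"
  "cdelta (cra_of_wfa A) = succ_states A"
  "cinit (cra_of_wfa A) = winit A"
  "cfinal (cra_of_wfa A) = reach A ` lists (walphabet A)"
  "cfin (cra_of_wfa A) S = state_index S ` (S \<inter> wfinal A)"
  by (simp_all add: cra_of_wfa_def)

lemma bij_betw_state_index:
  assumes "finite S"
  shows "bij_betw (state_index S) S {1..card S}"
proof -
  have "\<exists>f. bij_betw f S {1..card S}"
    using assms by (intro finite_same_card_bij) auto
  then show ?thesis unfolding state_index_def by (rule someI_ex)
qed

lemma state_index_mem:
  assumes "finite S" "q \<in> S"
  shows "state_index S q \<in> {1..card S}"
  using bij_betw_state_index[OF assms(1)] assms(2) by (auto dest: bij_betwE)

lemma index_state_index [simp]:
  assumes "finite S" "q \<in> S"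
  shows "index_state S (state_index S q) = q"
  using bij_betw_state_index[OF assms(1)] assms(2)
  by (simp add: index_state_def bij_betw_def)

text \<open>The subset construction, obtained from the weight recursion: the lower bound
  \<open>\<infinity>\<close> holds exactly when every summand is infinite.\<close>

lemma reach_snoc:
  assumes "is_wfa A" "a \<in> walphabet A"
  shows "reach A (w @ [a]) = succ_states A (reach A w) a"
proof (intro set_eqI)
  fix q
  show "q \<in> reach A (w @ [a]) \<longleftrightarrow> q \<in> succ_states A (reach A w) a"
  proof (cases "q \<in> wstates A")
    case True
    have "q \<in> reach A (w @ [a]) \<longleftrightarrow>
      (\<exists>p\<in>wstates A. reach_weight A w p \<noteq> \<infinity> \<and> trans_weight A p a q \<noteq> \<infinity>)"
      using le_reach_weight_snoc_iff[OF assms(1) True assms(2), of \<infinity> w]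
      by (auto simp: mem_reach_iff[OF assms(1)] zinf_add_eq_infinity_iff)
    then show ?thesis
      using True reach_subset_wstates[OF assms(1), of w]
      by (auto simp: succ_states_def mem_reach_iff[OF assms(1)])
  next
    case False
    then show ?thesis using reach_subset_wstates[OF assms(1)] by (auto simp: succ_states_def)
  qed
qed

lemma is_cra_cra_of_wfa:
  assumes A: "is_wfa A"
  shows "is_cra (width A) (cra_of_wfa A)"
proof -
  have "reach A ` lists (walphabet A) \<subseteq> Pow (wstates A)"
    using reach_subset_wstates[OF A] by auto
  then have "finite (reach A ` lists (walphabet A))"
    using A by (meson finite_Pow_iff finite_subset is_wfa_def)
  moreover have "finite (walphabet A)" using A by (simp add: is_wfa_def)
  moreover have "winit A \<in> reach A ` lists (walphabet A)"
    using reach_Nil[OF A] by (metis image_eqI lists.Nil)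
  moreover have "succ_states A (reach A w) a \<in> reach A ` lists (walphabet A)"
    if "w \<in> lists (walphabet A)" "a \<in> walphabet A" for w a
    using that reach_snoc[OF A that(2), of w] by (intro image_eqI[of _ _ "w @ [a]"]) auto
  moreover have "state_index (reach A w) q \<in> {1..width A}"
    if "w \<in> lists (walphabet A)" "q \<in> reach A w" for w q
    using state_index_mem[OF finite_reach[OF A] that(2)] card_reach_le_width[OF A that(1)]
    by auto
  ultimately show ?thesis unfolding is_cra_def cra_of_wfa_simps by blast
qed

text \<open>The invariant of the converse simulation. It constrains only registers that number a
  state of \<open>S\<close>; the contents of the others are left open.\<close>

lemma cra_config_cra_of_wfa:
  assumes A: "is_wfa A" and "w \<in> lists (walphabet A)"
    and "cra_config (width A) (cra_of_wfa A) w = (S, r)"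
  shows "S = reach A w \<and> (\<forall>q\<in>S. r (state_index S q) = reach_weight A w q)"
  using assms(2,3)
proof (induction w arbitrary: S r rule: rev_induct)
  case Nil
  \<comment> \<open>The initial register value 0 is the weight of the empty run at each initial
    state.\<close>
  then show ?case by (auto simp: reach_Nil[OF A] reach_weight_Nil[OF A])
next
  case (snoc a w)
  obtain S0 r0 where c: "cra_config (width A) (cra_of_wfa A) w = (S0, r0)" by fastforce
  have a: "a \<in> walphabet A" and w: "w \<in> lists (walphabet A)" using snoc.prems by auto
  note IH = snoc.IH[OF w c]
  have S: "S = succ_states A S0 a"
    and r: "r = vec_mat (width A) r0 (cupd (cra_of_wfa A) S0 a)"
    using snoc.prems(2) c by (simp_all add: cra_step_def)
  have SR: "S = reach A (w @ [a])" using S IH reach_snoc[OF A a] by simp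
  have fin: "finite S" "finite S0" using SR IH finite_reach[OF A] by auto
  have card: "card S0 \<le> width A" using IH card_reach_le_width[OF A w] by simp
  have "r (state_index S q) = reach_weight A (w @ [a]) q" if q: "q \<in> S" for q
  proof (rule zinf_eqI)
    fix x
    have qw: "q \<in> wstates A" using q SR reach_subset_wstates[OF A] by auto
    have "x \<le> r (state_index S q) \<longleftrightarrow>
      (\<forall>l\<in>{1..width A}. x \<le> r0 l +
        (if l \<in> {1..card S0} then trans_weight A (index_state S0 l) a q else \<infinity>))"
      using state_index_mem[OF fin(1) q] fin(1) q
      by (simp add: r le_vec_mat_iff cra_of_wfa_def S[symmetric])
    \<comment> \<open>Registers above \<open>card S0\<close> are masked by
      \<open>\<infinity>\<close>, and \<open>card S0 \<le> width A\<close> keeps all the others in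
      range.\<close>
    also have "\<dots> \<longleftrightarrow>
      (\<forall>l\<in>{1..card S0}. x \<le> r0 l + trans_weight A (index_state S0 l) a q)"
      using card by auto
    also have "\<dots> \<longleftrightarrow> (\<forall>p\<in>S0. x \<le> reach_weight A w p + trans_weight A p a q)"
      \<comment> \<open>Reindexing along the numbering: \<open>l\<close> becomes
        \<open>state_index S0 p\<close>, which \<open>index_state\<close> inverts, and the induction
        hypothesis reads the register.\<close>
      unfolding bij_betw_imp_surj_on[OF bij_betw_state_index[OF fin(2)], symmetric]
      using IH[THEN conjunct2] fin(2) by simp
    also have "\<dots> \<longleftrightarrow> (\<forall>p\<in>wstates A. x \<le> reach_weight A w p + trans_weight A p a q)"
    proof -
      \<comment> \<open>States outside \<open>S0\<close> are unreachable, hence have weight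
        \<open>\<infinity>\<close> and add no bound.\<close>
      have "x \<le> reach_weight A w p + trans_weight A p a q" if "p \<notin> S0" for p
        using that IH mem_reach_iff[OF A, of p w] by simp
      moreover have "S0 \<subseteq> wstates A" using IH reach_subset_wstates[OF A] by simp
      ultimately show ?thesis by blast
    qed
    also have "\<dots> \<longleftrightarrow> x \<le> reach_weight A (w @ [a]) q"
      using le_reach_weight_snoc_iff[OF A qw a] by simp
    finally show "x \<le> r (state_index S q) \<longleftrightarrow> x \<le> reach_weight A (w @ [a]) q" .
  qed
  with SR show ?case by simp
qed

lemma cra_value_cra_of_wfa:
  assumes A: "is_wfa A" and w: "w \<in> lists (walphabet A)"
  shows "cra_value (width A) (cra_of_wfa A) w = wfa_value A w"
proof (rule zinf_eqI)
  fix x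
  obtain S r where c: "cra_config (width A) (cra_of_wfa A) w = (S, r)" by fastforce
  note S = cra_config_cra_of_wfa[OF A w c]
  have "x \<le> cra_value (width A) (cra_of_wfa A) w \<longleftrightarrow>
    (\<forall>q\<in>S \<inter> wfinal A. x \<le> reach_weight A w q)"
    using le_cra_value_iff[OF is_cra_cra_of_wfa[OF A] c] S w by auto
  also have "\<dots> \<longleftrightarrow> x \<le> wfa_value A w"
  proof -
    have "x \<le> reach_weight A w q" if "q \<notin> S" for q
      using that S mem_reach_iff[OF A, of q w] by simp
    then show ?thesis unfolding le_wfa_value_iff[OF A] by blast
  qed
  finally show "x \<le> cra_value (width A) (cra_of_wfa A) w \<longleftrightarrow> x \<le> wfa_value A w" .
qed

theorem theorem21:
  fixes k :: nat and \<Sigma> :: "'a set"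
  assumes "k \<ge> 1" and "finite \<Sigma>"
  shows "cra_functions k \<Sigma> = wfa_functions k \<Sigma>"
proof (intro equalityI subsetI)
  fix f assume "f \<in> cra_functions k \<Sigma>"
  then obtain N :: "(nat, 'a) cra" where N: "is_cra k N" "calphabet N = \<Sigma>"
    and f: "f = restrict (cra_value k N) (lists \<Sigma>)" by (auto simp: cra_functions_def)
  have "f = restrict (wfa_value (wfa_of_cra k N)) (lists \<Sigma>)"
    unfolding f using wfa_value_wfa_of_cra[OF N(1)] N(2) by (intro restrict_ext) simp
  \<comment> \<open>The constructed states are pairs; the renaming result moves them back to natural
    numbers while preserving values and width.\<close>
  then show "f \<in> wfa_functions k \<Sigma>"
    using wfa_value_in_wfa_functions[OF is_wfa_wfa_of_cra[OF N(1)]] N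
    by (simp add: width_wfa_of_cra)
next
  fix f assume "f \<in> wfa_functions k \<Sigma>"
  then obtain A :: "(nat, 'a) wfa" where A: "is_wfa A" "walphabet A = \<Sigma>" "width A = k"
    and f: "f = restrict (wfa_value A) (lists \<Sigma>)" by (auto simp: wfa_functions_def)
  have "f = restrict (cra_value k (cra_of_wfa A)) (lists \<Sigma>)"
    unfolding f using cra_value_cra_of_wfa[OF A(1)] A(2,3) by (intro restrict_ext) simp
  \<comment> \<open>Here the states are sets of natural numbers, renamed likewise.\<close>
  then show "f \<in> cra_functions k \<Sigma>"
    using cra_value_in_cra_functions[OF is_cra_cra_of_wfa[OF A(1)]] A by simp
qed

end
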